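(* Let $G$ be a group and let $A$ be a finite set of generators of $G$ closed under inversion. Let $L$ be a regular language over $A$ such that the map $\pi\colon L\to G$ is finite-to-one and onto. Then $(A,L)$ is a biautomatic structure if and only if there exists some constant $k$ such that for all $w_1,w_2\in L$ and for all $a,b\in A\cup\{\varepsilon\}$ fulfilling $\pi(aw_1b)=\pi(w_2)$, the distance between the paths $\widehat{aw_1b}$ and $\widehat{w_2}$ is less than or equal to $k$.
   Context: Let $A$ be a finite alphabet generating a group $G$ as a semigroup. $A^*$ is the set of finite words over $A$ and $\varepsilon$ is the empty word. For $w\in A^*$, $\pi(w)\in G$ denotes the group element represented by $w$. $\Gamma(G,A)$ is the Cayley graph of $G$ with respect to $A$ (vertex set $G$, an edge from $g$ to $g\pi(a)$ for each $g\in G$, $a\in A$), regarded as a metric space with the path metric in which all edges have length 1 (edges may be traversed in both directions). For $w\in A^*$, $\widehat{w}\colon[0,\infty)\to\Gamma(G,A)$ is the path that travels at unit speed from the neutral element along the edges labelled by the successive letters of $w$ to $\pi(w)$, where it stays forever; thus at integer time $t$ it is at $\pi(w(t))$, where $w(t)$ is the prefix of $w$ of length $t$ (and $w(t)=w$ if $t$ is at least the length of $w$). The distance between two paths $\widehat{w_1}$ and $\widehat{w_2}$ is the synchronous uniform distance, i.e. the maximum over $t\in[0,\infty)$ of the distance in $\Gamma(G,A)$ between $\widehat{w_1}(t)$ and $\widehat{w_2}(t)$. The alphabet $A$ is closed under inversion if each $a\in A$ has an inverse letter $a^{-1}\in A$, with $(a^{-1})^{-1}=a$ and $\pi(a^{-1})=\pi(a)^{-1}$.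 For a word $w=a_1\cdots a_n$ put $w^{-1}=a_n^{-1}\cdots a_1^{-1}$ (formal inverse), and for a language $L\subset A^*$ put $L^{-1}=\{w^{-1}: w\in L\}$. Automatic structure: let $A$ be a finite set generating $G$ as a semigroup and let $L$ be a regular language over $A$ that maps onto $G$ under $\pi$. Then $(A,L)$ is an automatic structure if there exists a constant $k$ such that for all $w_1,w_2\in L$ and all $a\in A\cup\{\varepsilon\}$ fulfilling $\pi(w_1a)=\pi(w_2)$, the distance between $\widehat{w_1a}$ and $\widehat{w_2}$ is at most $k$. Biautomatic structure: let $A$ be an alphabet closed under inversion and let $L\subset A^*$ be a language that maps onto $G$. Then $(A,L)$ is a biautomatic structure if both $(A,L)$ and $(A,L^{-1})$ are automatic structures. The map $\pi\colon L\to G$ is finite-to-one if every element of $G$ is represented by at most finitely many words in $L$. *)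

theory Defs
  imports Complex_Main "HOL-Algebra.Generated_Groups"
begin

text \<open>An alphabet is a set \<open>A\<close> of letters together with an evaluation map
  \<open>ev\<close> from letters to group elements, which need not be injective on \<open>A\<close>.
  Words over \<open>A\<close> are the elements of \<^term>\<open>lists A\<close>.\<close>

definition word_val :: "('g, 'm) monoid_scheme \<Rightarrow> ('a \<Rightarrow> 'g) \<Rightarrow> 'a list \<Rightarrow> 'g" where
  "word_val G ev w = foldr (\<lambda>a g. ev a \<otimes>\<^bsub>G\<^esub> g) w \<one>\<^bsub>G\<^esub>"

text \<open>The empty word is admitted here, so the empty alphabet generates the trivial group;
  in all other cases this agrees with generation by nonempty words.\<close>

definition generates_as_semigroup ::
  "('g, 'm) monoid_scheme \<Rightarrow> 'a set \<Rightarrow> ('a \<Rightarrow> 'g) \<Rightarrow> bool" where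
  "generates_as_semigroup G A ev \<longleftrightarrow>
     ev \<in> A \<rightarrow> carrier G \<and> word_val G ev ` lists A = carrier G"

definition closed_under_inversion ::
  "('g, 'm) monoid_scheme \<Rightarrow> 'a set \<Rightarrow> ('a \<Rightarrow> 'g) \<Rightarrow> ('a \<Rightarrow> 'a) \<Rightarrow> bool" where
  "closed_under_inversion G A ev \<iota> \<longleftrightarrow>
     (\<forall>a\<in>A. \<iota> a \<in> A \<and> \<iota> (\<iota> a) = a \<and> ev (\<iota> a) = inv\<^bsub>G\<^esub> (ev a))"

definition word_inv :: "('a \<Rightarrow> 'a) \<Rightarrow> 'a list \<Rightarrow> 'a list" where
  "word_inv \<iota> w = rev (map \<iota> w)"

definition letters_or_empty :: "'a set \<Rightarrow> 'a list set" where
  "letters_or_empty A = {[]} \<union> {[a] | a. a \<in> A}"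

text \<open>Acceptance by a deterministic finite automaton. Taking states in \<^typ>\<open>nat\<close>
  is no restriction, since the state set is finite.\<close>

definition regular_language :: "'a set \<Rightarrow> 'a list set \<Rightarrow> bool" where
  "regular_language A L \<longleftrightarrow>
     (\<exists>(Q :: nat set) q0 \<delta> F.
        finite Q \<and> q0 \<in> Q \<and> F \<subseteq> Q \<and> (\<forall>q\<in>Q. \<forall>a\<in>A. \<delta> q a \<in> Q) \<and>
        L = {w \<in> lists A. foldl \<delta> q0 w \<in> F})"

text \<open>Points of the geometric realization of the Cayley graph: the vertices, and the point
  at parameter \<open>0 < s < 1\<close> of the open edge labelled \<open>a\<close> that starts at \<open>g\<close>.
  There is one edge for each pair \<open>(g, a)\<close>.\<close>

datatype ('g, 'a) cayley_point = Vertex 'g | Inner 'g 'a real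

text \<open>The characteristic map of the edge \<open>(g, a)\<close>, for parameters in \<open>[0, 1]\<close>.\<close>

definition edge_point ::
  "('g, 'm) monoid_scheme \<Rightarrow> ('a \<Rightarrow> 'g) \<Rightarrow> 'g \<Rightarrow> 'a \<Rightarrow> real \<Rightarrow> ('g, 'a) cayley_point" where
  "edge_point G ev g a s =
     (if s = 0 then Vertex g
      else if s = 1 then Vertex (g \<otimes>\<^bsub>G\<^esub> ev a)
      else Inner g a s)"

text \<open>\<open>cayley_path G A ev p q l\<close>: some piecewise linear path of length \<open>l\<close> leads from
  \<open>p\<close> to \<open>q\<close>. Every linear piece runs within one closed edge, in either direction.\<close>

inductive cayley_path ::
  "('g, 'm) monoid_scheme \<Rightarrow> 'a set \<Rightarrow> ('a \<Rightarrow> 'g) \<Rightarrow>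
     ('g, 'a) cayley_point \<Rightarrow> ('g, 'a) cayley_point \<Rightarrow> real \<Rightarrow> bool"
  for G A ev where
  refl: "cayley_path G A ev p p 0"
| step: "cayley_path G A ev p (edge_point G ev g a s) l \<Longrightarrow>
     g \<in> carrier G \<Longrightarrow> a \<in> A \<Longrightarrow> s \<in> {0..1} \<Longrightarrow> t \<in> {0..1} \<Longrightarrow>
     cayley_path G A ev p (edge_point G ev g a t) (l + \<bar>t - s\<bar>)"

text \<open>The path metric. The infimum is over a nonempty set whenever the graph is connected,
  in particular whenever \<open>A\<close> generates \<open>G\<close>.\<close>

definition cayley_dist ::
  "('g, 'm) monoid_scheme \<Rightarrow> 'a set \<Rightarrow> ('a \<Rightarrow> 'g) \<Rightarrow>
     ('g, 'a) cayley_point \<Rightarrow> ('g, 'a) cayley_point \<Rightarrow> real" where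
  "cayley_dist G A ev p q = Inf {l. cayley_path G A ev p q l}"

definition word_path ::
  "('g, 'm) monoid_scheme \<Rightarrow> ('a \<Rightarrow> 'g) \<Rightarrow> 'a list \<Rightarrow> real \<Rightarrow> ('g, 'a) cayley_point" where
  "word_path G ev w t =
     (if t \<ge> real (length w) then Vertex (word_val G ev w)
      else let n = nat \<lfloor>t\<rfloor>
           in edge_point G ev (word_val G ev (take n w)) (w ! n) (t - real n))"

text \<open>The supremum is finite because both paths are eventually constant.\<close>

definition path_dist ::
  "('g, 'm) monoid_scheme \<Rightarrow> 'a set \<Rightarrow> ('a \<Rightarrow> 'g) \<Rightarrow> 'a list \<Rightarrow> 'a list \<Rightarrow> real" where
  "path_dist G A ev w1 w2 =
     (SUP t\<in>{0..}. cayley_dist G A ev (word_path G ev w1 t) (word_path G ev w2 t))"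

definition automatic_structure ::
  "('g, 'm) monoid_scheme \<Rightarrow> ('a \<Rightarrow> 'g) \<Rightarrow> 'a set \<Rightarrow> 'a list set \<Rightarrow> bool" where
  "automatic_structure G ev A L \<longleftrightarrow>
     finite A \<and> generates_as_semigroup G A ev \<and>
     regular_language A L \<and> word_val G ev ` L = carrier G \<and>
     (\<exists>k :: real. \<forall>w1\<in>L. \<forall>w2\<in>L. \<forall>a\<in>letters_or_empty A.
        word_val G ev (w1 @ a) = word_val G ev w2 \<longrightarrow>
        path_dist G A ev (w1 @ a) w2 \<le> k)"

definition biautomatic_structure ::
  "('g, 'm) monoid_scheme \<Rightarrow> ('a \<Rightarrow> 'g) \<Rightarrow> ('a \<Rightarrow> 'a) \<Rightarrow> 'a set \<Rightarrow> 'a list set \<Rightarrow> bool" where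
  "biautomatic_structure G ev \<iota> A L \<longleftrightarrow>
     closed_under_inversion G A ev \<iota> \<and>
     L \<subseteq> lists A \<and> word_val G ev ` L = carrier G \<and>
     automatic_structure G ev A L \<and>
     automatic_structure G ev A (word_inv \<iota> ` L)"

definition finite_to_one ::
  "('g, 'm) monoid_scheme \<Rightarrow> ('a \<Rightarrow> 'g) \<Rightarrow> 'a list set \<Rightarrow> bool" where
  "finite_to_one G ev L \<longleftrightarrow> (\<forall>g\<in>carrier G. finite {w \<in> L. word_val G ev w = g})"

end

theory Submission
  imports Defs
begin

text \<open>The point is that reversing a pair of fellow travelling words with the same value keeps
  them fellow travelling as soon as their lengths differ by a bounded amount. The length bound
  comes from pumping: if the end of a word of \<open>L\<close> stays near its endpoint for longer than the
  number of pairs of an automaton state and an element of a ball, then some nonempty subword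
  with trivial value can be repeated, against \<open>L\<close> being finite-to-one. Hence left multiplication
  by a letter in \<open>L\<close> and right multiplication by a letter in \<open>L\<^sup>-\<^sup>1\<close> amount to the same
  condition, and the two one-sided conditions for \<open>a w\<^sub>1 b\<close> are joined through a
  representative \<open>w\<^sub>3 \<in> L\<close> of \<open>w\<^sub>1 b\<close>.\<close>

text \<open>The definition of \<open>regular_language\<close> takes states in \<open>nat\<close>.
  The backward automaton for the inverse language has sets of states as its states, so arbitrary
  finite state sets are renumbered here.\<close>

lemma regular_languageI:
  fixes Q :: "'s set"
  assumes "finite Q" "q0 \<in> Q" and closed: "\<And>q a. q \<in> Q \<Longrightarrow> a \<in> A \<Longrightarrow> \<delta> q a \<in> Q"
    and L: "L = {w \<in> lists A. foldl \<delta> q0 w \<in> F}"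
  shows "regular_language A L"
proof -
  obtain e :: "'s \<Rightarrow> nat" where e: "inj_on e Q"
    using finite_imp_inj_to_nat_seg[OF assms(1)] by blast
  define d where "d = inv_into Q e"
  have de: "d (e q) = q" if "q \<in> Q" for q
    using e that unfolding d_def by simp
  define \<delta>' where "\<delta>' n a = e (\<delta> (d n) a)" for n a
  have run: "foldl \<delta>' (e q) w = e (foldl \<delta> q w) \<and> foldl \<delta> q w \<in> Q"
    if "w \<in> lists A" "q \<in> Q" for w q
    using that by (induction w arbitrary: q) (simp_all add: \<delta>'_def de closed)
  \<comment> \<open>The coding \<open>e\<close> is injective on \<open>Q\<close> only, so the
    accepting set is cut down to \<open>Q\<close> before it is transported.\<close>
  have "foldl \<delta>' (e q0) w \<in> e ` (F \<inter> Q) \<longleftrightarrow> foldl \<delta> q0 w \<in> F" if "w \<in> lists A" for w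
    using run[OF that assms(2)] inj_on_image_mem_iff[OF e, of _ "F \<inter> Q"] by auto
  then have "L = {w \<in> lists A. foldl \<delta>' (e q0) w \<in> e ` (F \<inter> Q)}"
    unfolding L by blast
  moreover have "\<forall>n\<in>e ` Q. \<forall>a\<in>A. \<delta>' n a \<in> e ` Q"
    by (auto simp: \<delta>'_def de closed)
  ultimately show ?thesis
    unfolding regular_language_def using assms(1,2)
    by (intro exI[of _ "e ` Q"] exI[of _ "e q0"] exI[of _ \<delta>'] exI[of _ "e ` (F \<inter> Q)"]) auto
qed

lemma regular_language_subset: "regular_language A L \<Longrightarrow> L \<subseteq> lists A"
  unfolding regular_language_def by blast

lemma word_inv_append: "word_inv \<iota> (u @ v) = word_inv \<iota> v @ word_inv \<iota> u"
  by (simp add: word_inv_def)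

lemma length_word_inv [simp]: "length (word_inv \<iota> w) = length w"
  by (simp add: word_inv_def)

locale inverse_closed_generators = group G for G :: "('g, 'm) monoid_scheme" (structure) +
  fixes A :: "'a set" and ev :: "'a \<Rightarrow> 'g" and \<iota> :: "'a \<Rightarrow> 'a"
  assumes fin: "finite A"
    and ev: "ev \<in> A \<rightarrow> carrier G"
    and closed_inv: "closed_under_inversion G A ev \<iota>"
    and gen: "word_val G ev ` lists A = carrier G"
begin

declare in_lists_conv_set [simp del] in_listsI [rule del] in_listsD [rule del]

section \<open>Values of words and of their formal inverses\<close>

abbreviation val :: "'a list \<Rightarrow> 'g" where "val \<equiv> word_val G ev"

lemma inv_mult_cancel [simp]:
  assumes "g \<in> carrier G" "h \<in> carrier G"
  shows "inv g \<otimes> (g \<otimes> h) = h" "g \<otimes> (inv g \<otimes> h) = h"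
  using assms by (simp_all flip: m_assoc)

lemma val_Nil [simp]: "val [] = \<one>"
  by (simp add: word_val_def)

lemma val_Cons: "val (a # w) = ev a \<otimes> val w"
  by (simp add: word_val_def)

lemma ev_closed [simp, intro]: "a \<in> A \<Longrightarrow> ev a \<in> carrier G"
  using ev by auto

lemma val_closed [simp, intro]: "w \<in> lists A \<Longrightarrow> val w \<in> carrier G"
  using gen by blast

lemma val_single [simp]: "a \<in> A \<Longrightarrow> val [a] = ev a"
  by (simp add: val_Cons)

lemma val_append: "u \<in> lists A \<Longrightarrow> v \<in> lists A \<Longrightarrow> val (u @ v) = val u \<otimes> val v"
  by (induction u) (auto simp: val_Cons m_assoc)

lemma iota [simp]: "a \<in> A \<Longrightarrow> \<iota> a \<in> A" "a \<in> A \<Longrightarrow> \<iota> (\<iota> a) = a"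
    "a \<in> A \<Longrightarrow> ev (\<iota> a) = inv (ev a)"
  using closed_inv by (auto simp: closed_under_inversion_def)

lemma word_inv_lists [simp]: "w \<in> lists A \<Longrightarrow> word_inv \<iota> w \<in> lists A"
  by (auto simp: word_inv_def in_lists_conv_set)

lemma word_inv_word_inv [simp]: "w \<in> lists A \<Longrightarrow> word_inv \<iota> (word_inv \<iota> w) = w"
  by (induction w) (auto simp: word_inv_def)

lemma val_word_inv: "w \<in> lists A \<Longrightarrow> val (word_inv \<iota> w) = inv (val w)"
proof (induction w)
  case Nil
  then show ?case by (simp add: word_inv_def)
next
  case (Cons a w)
  then have "val (word_inv \<iota> w @ [\<iota> a]) = inv (val w) \<otimes> inv (ev a)"
    by (subst val_append) auto
  with Cons show ?case
    by (simp add: word_inv_def val_Cons inv_mult_group)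
qed

lemma take_lists [simp]: "w \<in> lists A \<Longrightarrow> take n w \<in> lists A"
  by (auto simp: in_lists_conv_set dest: in_set_takeD)

lemma drop_lists [simp]: "w \<in> lists A \<Longrightarrow> drop n w \<in> lists A"
  by (auto simp: in_lists_conv_set dest: in_set_dropD)

lemma letters_or_empty_lists: "a \<in> letters_or_empty A \<Longrightarrow> a \<in> lists A"
  and letters_or_empty_length: "a \<in> letters_or_empty A \<Longrightarrow> length a \<le> 1"
  and letters_or_empty_word_inv: "a \<in> letters_or_empty A \<Longrightarrow> word_inv \<iota> a \<in> letters_or_empty A"
  by (auto simp: letters_or_empty_def word_inv_def)

subsection \<open>The word metric\<close>

definition word_norm :: "'g \<Rightarrow> nat" where
  "word_norm g = (LEAST n. \<exists>u\<in>lists A. length u = n \<and> val u = g)"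

lemma word_norm_witness:
  assumes "g \<in> carrier G"
  obtains u where "u \<in> lists A" "length u = word_norm g" "val u = g"
proof -
  have "\<exists>n. \<exists>u\<in>lists A. length u = n \<and> val u = g"
    using assms unfolding gen[symmetric] by blast
  from LeastI_ex[OF this] show ?thesis
    using that unfolding word_norm_def by blast
qed

lemma word_norm_val_le: "u \<in> lists A \<Longrightarrow> word_norm (val u) \<le> length u"
  unfolding word_norm_def by (rule Least_le) blast

lemma word_norm_one [simp]: "word_norm \<one> = 0"
  using word_norm_val_le[of "[]"] by simp

lemma word_norm_mult_le:
  assumes "g \<in> carrier G" "h \<in> carrier G"
  shows "word_norm (g \<otimes> h) \<le> word_norm g + word_norm h"
proof -
  obtain u where "u \<in> lists A" "length u = word_norm g" "val u = g"
    using word_norm_witness[OF assms(1)] .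
  moreover obtain v where "v \<in> lists A" "length v = word_norm h" "val v = h"
    using word_norm_witness[OF assms(2)] .
  ultimately show ?thesis
    using word_norm_val_le[of "u @ v"] by (simp add: val_append)
qed

text \<open>The formal inverse of a shortest word for \<open>g\<close> has the same length and
  represents \<open>inv g\<close>. Closure of \<open>A\<close> under inversion thus makes
  \<open>word_dist\<close> symmetric, in accordance with edges being traversed in both
  directions.\<close>

lemma word_norm_inv_le:
  assumes "g \<in> carrier G"
  shows "word_norm (inv g) \<le> word_norm g"
proof -
  obtain u where "u \<in> lists A" "length u = word_norm g" "val u = g"
    using word_norm_witness[OF assms] .
  then show ?thesis
    using word_norm_val_le[of "word_inv \<iota> u"] by (simp add: val_word_inv)
qed

text \<open>The ball is covered by the values of the finitely many words of length at most
  \<open>K\<close>. The pigeonhole argument for the tails of words counts its elements.\<close>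

lemma finite_word_ball: "finite {g \<in> carrier G. word_norm g \<le> K}"
proof (rule finite_subset)
  show "{g \<in> carrier G. word_norm g \<le> K} \<subseteq> val ` {u. set u \<subseteq> A \<and> length u \<le> K}"
  proof
    fix g assume g: "g \<in> {g \<in> carrier G. word_norm g \<le> K}"
    then obtain u where "u \<in> lists A" "length u = word_norm g" "val u = g"
      using word_norm_witness[of g] by auto
    with g show "g \<in> val ` {u. set u \<subseteq> A \<and> length u \<le> K}"
      by (force simp: in_lists_conv_set)
  qed
  show "finite (val ` {u. set u \<subseteq> A \<and> length u \<le> K})"
    using finite_lists_length_le[OF fin] by auto
qed

definition word_dist :: "'g \<Rightarrow> 'g \<Rightarrow> nat" where
  "word_dist g h = word_norm (inv g \<otimes> h)"

lemma word_dist_self [simp]: "g \<in> carrier G \<Longrightarrow> word_dist g g = 0"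
  by (simp add: word_dist_def)

lemma word_dist_triangle:
  assumes "g \<in> carrier G" "h \<in> carrier G" "k \<in> carrier G"
  shows "word_dist g k \<le> word_dist g h + word_dist h k"
proof -
  have "inv g \<otimes> k = (inv g \<otimes> h) \<otimes> (inv h \<otimes> k)"
    using assms by (simp add: m_assoc)
  then show ?thesis
    unfolding word_dist_def using assms word_norm_mult_le by simp
qed

lemma word_dist_commute:
  assumes "g \<in> carrier G" "h \<in> carrier G"
  shows "word_dist g h = word_dist h g"
proof -
  have "inv (inv g \<otimes> h) = inv h \<otimes> g" "inv (inv h \<otimes> g) = inv g \<otimes> h"
    using assms by (simp_all add: inv_mult_group)
  then show ?thesis
    unfolding word_dist_def using word_norm_inv_le assms by (metis inv_closed m_closed le_antisym)
qed

lemma word_dist_mult_left: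
  assumes "x \<in> carrier G" "g \<in> carrier G" "h \<in> carrier G"
  shows "word_dist (x \<otimes> g) (x \<otimes> h) = word_dist g h"
proof -
  have "inv (x \<otimes> g) \<otimes> (x \<otimes> h) = inv g \<otimes> h"
    using assms by (simp add: inv_mult_group m_assoc)
  then show ?thesis by (simp add: word_dist_def)
qed

lemma word_dist_val_le:
  assumes "g \<in> carrier G" "u \<in> lists A"
  shows "word_dist g (g \<otimes> val u) \<le> length u"
proof -
  have "inv g \<otimes> (g \<otimes> val u) = val u"
    using assms by simp
  then show ?thesis using word_norm_val_le[OF assms(2)] by (simp add: word_dist_def)
qed

text \<open>The longer prefix extends the shorter one by a word whose length is at most the
  difference of \<open>m\<close> and \<open>n\<close>. That difference is written with
  \<open>max\<close> and \<open>min\<close> because subtraction on \<open>nat\<close> is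
  truncated.\<close>

lemma word_dist_take_le:
  assumes "w \<in> lists A"
  shows "word_dist (val (take m w)) (val (take n w)) \<le> max m n - min m n"
proof -
  have *: "word_dist (val (take i w)) (val (take j w)) \<le> j - i" if "i \<le> j" for i j
  proof -
    have "take j w = take i w @ drop i (take j w)"
      using that by (metis append_take_drop_id min.absorb1 take_take)
    then have "val (take j w) = val (take i w) \<otimes> val (drop i (take j w))"
      using val_append[of "take i w" "drop i (take j w)"] assms by simp
    then show ?thesis
      using word_dist_val_le[of "val (take i w)" "drop i (take j w)"] assms by simp
  qed
  show ?thesis
    using *[of m n] *[of n m] word_dist_commute[of "val (take m w)" "val (take n w)"] assms
    by (cases "m \<le> n") auto
qed

subsection \<open>Comparison with the path metric\<close>

lemma cayley_path_trans:
  assumes "cayley_path G A ev q r m" "cayley_path G A ev p q l"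
  shows "cayley_path G A ev p r (l + m)"
  using assms
proof (induction rule: cayley_path.induct)
  case (refl q)
  then show ?case by simp
next
  case (step q g a s m t)
  then have "cayley_path G A ev p (edge_point G ev g a t) ((l + m) + \<bar>t - s\<bar>)"
    by (intro cayley_path.step) auto
  then show ?case by (simp add: add.assoc)
qed

lemma cayley_path_edge:
  "g \<in> carrier G \<Longrightarrow> a \<in> A \<Longrightarrow> s \<in> {0..1} \<Longrightarrow> t \<in> {0..1} \<Longrightarrow>
    cayley_path G A ev (edge_point G ev g a s) (edge_point G ev g a t) \<bar>t - s\<bar>"
  using cayley_path.step[OF cayley_path.refl, of g G a A s t ev] by simp

lemma cayley_path_nonneg: "cayley_path G A ev p q l \<Longrightarrow> 0 \<le> l"
  by (induction rule: cayley_path.induct) auto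

lemma bdd_below_cayley_path: "bdd_below {l. cayley_path G A ev p q l}"
  using cayley_path_nonneg by (auto intro!: bdd_belowI[of _ 0])

lemma cayley_dist_le: "cayley_path G A ev p q l \<Longrightarrow> cayley_dist G A ev p q \<le> l"
  unfolding cayley_dist_def by (intro cInf_lower bdd_below_cayley_path) simp

lemma cayley_path_word:
  assumes "g \<in> carrier G" "u \<in> lists A"
  shows "cayley_path G A ev (Vertex g) (Vertex (g \<otimes> val u)) (length u)"
  using assms(2,1)
proof (induction u arbitrary: g)
  case Nil
  then show ?case using cayley_path.refl[of G A ev "Vertex g"] by simp
next
  case (Cons a u)
  have "cayley_path G A ev (Vertex (g \<otimes> ev a)) (Vertex (g \<otimes> ev a \<otimes> val u)) (length u)"
    using Cons by auto
  moreover have "cayley_path G A ev (Vertex g) (Vertex (g \<otimes> ev a)) 1"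
    using cayley_path_edge[of g a 0 1] Cons by (simp add: edge_point_def)
  ultimately have "cayley_path G A ev (Vertex g) (Vertex (g \<otimes> ev a \<otimes> val u)) (1 + length u)"
    using cayley_path_trans by fastforce
  then show ?case using Cons by (simp add: val_Cons m_assoc)
qed

lemma cayley_path_vertices:
  assumes "g \<in> carrier G" "h \<in> carrier G"
  shows "cayley_path G A ev (Vertex g) (Vertex h) (word_dist g h)"
proof -
  obtain u where u: "u \<in> lists A" "length u = word_norm (inv g \<otimes> h)" "val u = inv g \<otimes> h"
    using word_norm_witness[of "inv g \<otimes> h"] assms by auto
  then have "g \<otimes> val u = h" using assms by simp
  then show ?thesis using cayley_path_word[OF assms(1) u(1)] u(2) by (simp add: word_dist_def)
qed

text \<open>The word metric extended to the inner points of the edges is \<open>1\<close>-Lipschitz along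
  every edge, so no path in the graph is a shortcut.\<close>

fun dist_from :: "'g \<Rightarrow> ('g, 'a) cayley_point \<Rightarrow> real" where
  "dist_from x (Vertex g) = word_dist x g"
| "dist_from x (Inner g a s) = min (real (word_dist x g) + s) (real (word_dist x (g \<otimes> ev a)) + 1 - s)"

text \<open>The formula for inner points persists at both ends of the edge: adjacent vertices have
  distances from \<open>x\<close> that differ by at most 1, so at \<open>s = 0\<close> and
  \<open>s = 1\<close> the minimum is attained by the term of the vertex itself.\<close>

lemma dist_from_edge_point:
  assumes "x \<in> carrier G" "g \<in> carrier G" "a \<in> A"
  shows "dist_from x (edge_point G ev g a s) =
    min (real (word_dist x g) + s) (real (word_dist x (g \<otimes> ev a)) + 1 - s)"
proof -
  have "word_dist g (g \<otimes> ev a) \<le> 1"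
    using word_dist_val_le[of g "[a]"] assms by simp
  moreover have "word_dist (g \<otimes> ev a) g = word_dist g (g \<otimes> ev a)"
    using assms by (intro word_dist_commute) auto
  ultimately have "word_dist x (g \<otimes> ev a) \<le> word_dist x g + 1"
      "word_dist x g \<le> word_dist x (g \<otimes> ev a) + 1"
    using word_dist_triangle[of x g "g \<otimes> ev a"] word_dist_triangle[of x "g \<otimes> ev a" g] assms
    by fastforce+
  then show ?thesis by (auto simp: edge_point_def)
qed

lemma dist_from_cayley_path:
  assumes "cayley_path G A ev p q l" "x \<in> carrier G"
  shows "dist_from x q \<le> dist_from x p + l"
  using assms
  by (induction rule: cayley_path.induct) (auto simp: dist_from_edge_point)

text \<open>A shortest word gives a path of length \<open>word_dist g h\<close>. Conversely
  \<open>dist_from g\<close> vanishes at \<open>Vertex g\<close> and grows by at most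
  \<open>l\<close> along a path of length \<open>l\<close>, which bounds every such length from
  below.\<close>

lemma cayley_dist_vertices:
  assumes "g \<in> carrier G" "h \<in> carrier G"
  shows "cayley_dist G A ev (Vertex g) (Vertex h) = word_dist g h"
proof (rule antisym)
  show "cayley_dist G A ev (Vertex g) (Vertex h) \<le> word_dist g h"
    by (intro cayley_dist_le cayley_path_vertices assms)
  show "word_dist g h \<le> cayley_dist G A ev (Vertex g) (Vertex h)"
    unfolding cayley_dist_def
  proof (rule cInf_greatest)
    show "{l. cayley_path G A ev (Vertex g) (Vertex h) l} \<noteq> {}"
      using cayley_path_vertices[OF assms] by blast
  qed (use dist_from_cayley_path[of "Vertex g" "Vertex h" _ g] assms in auto)
qed

text \<open>Comparing the paths at integer times suffices: in between, each of them stays within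
  distance \<open>1\<close> of its last vertex.\<close>

definition fellow :: "nat \<Rightarrow> 'a list \<Rightarrow> 'a list \<Rightarrow> bool" where
  "fellow K u v \<longleftrightarrow> (\<forall>n. word_dist (val (take n u)) (val (take n v)) \<le> K)"

lemma word_path_of_nat: "word_path G ev w (real n) = Vertex (val (take n w))"
  by (simp add: word_path_def edge_point_def)

text \<open>Both directions are recorded with one length: comparing two words means going back to
  the last vertex on one path and forward from the last vertex on the other.\<close>

lemma word_path_near_vertex:
  assumes "w \<in> lists A" "0 \<le> t"
  obtains l where "l \<le> 1"
    and "cayley_path G A ev (word_path G ev w t) (Vertex (val (take (nat \<lfloor>t\<rfloor>) w))) l"
    and "cayley_path G A ev (Vertex (val (take (nat \<lfloor>t\<rfloor>) w))) (word_path G ev w t) l"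
proof (cases "t \<ge> real (length w)")
  case True
  then have "take (nat \<lfloor>t\<rfloor>) w = w" by (simp add: le_nat_floor)
  with True show ?thesis
    using that[of 0] cayley_path.refl[of G A ev "Vertex (val w)"] by (simp add: word_path_def)
next
  case False
  define n where "n = nat \<lfloor>t\<rfloor>"
  have n: "n < length w" using False assms(2) unfolding n_def by linarith
  have s: "t - real n \<in> {0..1}" using assms(2) unfolding n_def by auto linarith
  have e: "val (take n w) \<in> carrier G" "w ! n \<in> A"
    using assms(1) nth_mem[OF n] by (auto simp del: nth_mem dest: in_listsD)
  have "word_path G ev w t = edge_point G ev (val (take n w)) (w ! n) (t - real n)"
    using False by (simp add: word_path_def n_def Let_def)
  moreover have "Vertex (val (take n w)) = edge_point G ev (val (take n w)) (w ! n) 0"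
    by (simp add: edge_point_def)
  ultimately show ?thesis
    using that[of "t - real n"] cayley_path_edge[OF e s, of 0] cayley_path_edge[OF e _ s, of 0] s
    unfolding n_def by auto
qed

text \<open>The path goes back to the last vertex passed by \<open>u\<close>, across to that of
  \<open>v\<close> at cost at most \<open>K\<close>, and forward along \<open>v\<close>. The two end
  pieces account for the summand 2.\<close>

lemma cayley_dist_word_path_le:
  assumes "fellow K u v" "u \<in> lists A" "v \<in> lists A" "0 \<le> t"
  shows "cayley_dist G A ev (word_path G ev u t) (word_path G ev v t) \<le> K + 2"
proof -
  let ?n = "nat \<lfloor>t\<rfloor>"
  obtain l where l: "l \<le> 1"
      "cayley_path G A ev (word_path G ev u t) (Vertex (val (take ?n u))) l"
    using word_path_near_vertex[OF assms(2,4)] by metis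
  obtain m where m: "m \<le> 1"
      "cayley_path G A ev (Vertex (val (take ?n v))) (word_path G ev v t) m"
    using word_path_near_vertex[OF assms(3,4)] by metis
  have "cayley_path G A ev (Vertex (val (take ?n u))) (Vertex (val (take ?n v)))
      (word_dist (val (take ?n u)) (val (take ?n v)))"
    using assms by (intro cayley_path_vertices) auto
  from cayley_dist_le[OF cayley_path_trans[OF m(2) cayley_path_trans[OF this l(2)]]]
  have "cayley_dist G A ev (word_path G ev u t) (word_path G ev v t)
      \<le> l + word_dist (val (take ?n u)) (val (take ?n v)) + m" .
  moreover have "word_dist (val (take ?n u)) (val (take ?n v)) \<le> K"
    using assms(1) by (simp add: fellow_def)
  ultimately show ?thesis using l(1) m(1) by linarith
qed

lemma path_dist_le_if_fellow:
  assumes "fellow K u v" "u \<in> lists A" "v \<in> lists A"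
  shows "path_dist G A ev u v \<le> K + 2"
  unfolding path_dist_def
proof (rule cSUP_least)
  show "cayley_dist G A ev (word_path G ev u t) (word_path G ev v t) \<le> K + 2"
    if "t \<in> {0..}" for t
    using cayley_dist_word_path_le[OF assms] that by simp
qed simp

text \<open>Each path stays in a ball around the neutral element. This crude constant serves to show
  that the supremum in \<open>path_dist\<close> is taken over a set that is bounded above.\<close>

lemma fellow_exists:
  assumes "u \<in> lists A" "v \<in> lists A"
  shows "fellow (length u + length v) u v"
  unfolding fellow_def
proof
  fix n
  have bound: "word_dist \<one> (val (take n w)) \<le> length w" if "w \<in> lists A" for w
    using word_dist_val_le[of \<one> "take n w"] that by simp
  have "word_dist (val (take n u)) (val (take n v))
      \<le> word_dist (val (take n u)) \<one> + word_dist \<one> (val (take n v))"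
    using assms by (intro word_dist_triangle) auto
  also have "word_dist (val (take n u)) \<one> = word_dist \<one> (val (take n u))"
    using assms by (intro word_dist_commute) auto
  also have "\<dots> + word_dist \<one> (val (take n v)) \<le> length u + length v"
    by (intro add_mono bound assms)
  finally show "word_dist (val (take n u)) (val (take n v)) \<le> length u + length v" .
qed

text \<open>The supremum dominates the distances at integer times. These are natural numbers, so
  rounding \<open>k\<close> down loses nothing.\<close>

lemma fellow_if_path_dist_le:
  assumes "path_dist G A ev u v \<le> k" "u \<in> lists A" "v \<in> lists A"
  shows "fellow (nat \<lfloor>k\<rfloor>) u v"
  unfolding fellow_def
proof
  fix n
  have "bdd_above ((\<lambda>t. cayley_dist G A ev (word_path G ev u t) (word_path G ev v t)) ` {0..})"
    using cayley_dist_word_path_le[OF fellow_exists[OF assms(2,3)] assms(2,3)]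
    by (auto intro!: bdd_aboveI2)
  then have "cayley_dist G A ev (word_path G ev u (real n)) (word_path G ev v (real n))
      \<le> path_dist G A ev u v"
    unfolding path_dist_def by (intro cSUP_upper) auto
  then have "word_dist (val (take n u)) (val (take n v)) \<le> k"
    using assms by (simp add: word_path_of_nat cayley_dist_vertices)
  then show "word_dist (val (take n u)) (val (take n v)) \<le> nat \<lfloor>k\<rfloor>"
    by (simp add: le_nat_floor)
qed

text \<open>With an arbitrary set \<open>P\<close> of pairs, one statement covers both the one-sided
  condition of automatic structures and the two-sided condition.\<close>

lemma path_dist_bounded_iff_fellow:
  assumes "\<And>u v. (u, v) \<in> P \<Longrightarrow> u \<in> lists A \<and> v \<in> lists A"
  shows "(\<exists>k. \<forall>(u, v)\<in>P. path_dist G A ev u v \<le> k) \<longleftrightarrow> (\<exists>K. \<forall>(u, v)\<in>P. fellow K u v)"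
proof
  assume "\<exists>k. \<forall>(u, v)\<in>P. path_dist G A ev u v \<le> k"
  then obtain k where "\<forall>(u, v)\<in>P. path_dist G A ev u v \<le> k" ..
  then have "\<forall>(u, v)\<in>P. fellow (nat \<lfloor>k\<rfloor>) u v"
    using assms fellow_if_path_dist_le by blast
  then show "\<exists>K. \<forall>(u, v)\<in>P. fellow K u v" ..
next
  assume "\<exists>K. \<forall>(u, v)\<in>P. fellow K u v"
  then obtain K where "\<forall>(u, v)\<in>P. fellow K u v" ..
  then have "\<forall>(u, v)\<in>P. path_dist G A ev u v \<le> K + 2"
    using assms path_dist_le_if_fellow by blast
  then show "\<exists>k. \<forall>(u, v)\<in>P. path_dist G A ev u v \<le> k" ..
qed

subsection \<open>Reversal of fellow travelling words\<close>

lemma fellow_trans: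
  assumes "fellow K u v" "fellow K' v w" "u \<in> lists A" "v \<in> lists A" "w \<in> lists A"
  shows "fellow (K + K') u w"
  unfolding fellow_def
proof
  fix n
  have "word_dist (val (take n u)) (val (take n w))
      \<le> word_dist (val (take n u)) (val (take n v)) + word_dist (val (take n v)) (val (take n w))"
    using assms by (intro word_dist_triangle) auto
  also have "\<dots> \<le> K + K'"
    using assms(1,2) by (auto simp: fellow_def intro: add_mono)
  finally show "word_dist (val (take n u)) (val (take n w)) \<le> K + K'" .
qed

text \<open>While \<open>a\<close> is being read the two paths coincide; afterwards both are
  translated by \<open>val a\<close>, which is an isometry.\<close>

lemma fellow_prepend:
  assumes "fellow K u v" "a \<in> lists A" "u \<in> lists A" "v \<in> lists A"
  shows "fellow K (a @ u) (a @ v)"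
  using assms unfolding fellow_def by (auto simp: val_append word_dist_mult_left)

text \<open>The path of the formal inverse is the path of \<open>w\<close> run backwards and
  translated so that it starts at the neutral element. For \<open>n\<close> beyond the length of
  \<open>w\<close>, truncated subtraction gives the empty prefix and hence the correct value
  \<open>inv (val w)\<close>.\<close>

lemma val_take_word_inv:
  assumes "w \<in> lists A"
  shows "val (take n (word_inv \<iota> w)) = inv (val w) \<otimes> val (take (length w - n) w)"
proof -
  let ?x = "take (length w - n) w" and ?y = "drop (length w - n) w"
  have "word_inv \<iota> w = word_inv \<iota> ?y @ word_inv \<iota> ?x"
    by (metis append_take_drop_id word_inv_append)
  moreover have "length ?y \<le> n" "n < length w \<Longrightarrow> length ?y = n" by auto
  ultimately have "take n (word_inv \<iota> w) = word_inv \<iota> ?y"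
    by (cases "n < length w") auto
  then have "val (take n (word_inv \<iota> w)) = inv (val ?y)"
    using assms by (simp add: val_word_inv)
  moreover have "val w = val ?x \<otimes> val ?y"
    using assms val_append[of ?x ?y] by simp
  ultimately show ?thesis
    using assms by (simp add: inv_mult_group m_assoc)
qed

text \<open>Because \<open>u\<close> and \<open>v\<close> have the same value, both backward paths
  are translated by the same element. At time \<open>n\<close> they are at the prefixes of lengths
  \<open>length u - n\<close> and \<open>length v - n\<close>, and shifting one of these times to
  the other costs at most \<open>C\<close>.\<close>

lemma fellow_word_inv:
  assumes "fellow K u v" "u \<in> lists A" "v \<in> lists A" "val u = val v"
    and "length u \<le> length v + C" "length v \<le> length u + C"
  shows "fellow (K + C) (word_inv \<iota> u) (word_inv \<iota> v)"
  unfolding fellow_def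
proof
  fix n
  let ?i = "length u - n" and ?j = "length v - n"
  have "word_dist (val (take n (word_inv \<iota> u))) (val (take n (word_inv \<iota> v)))
      = word_dist (val (take ?i u)) (val (take ?j v))"
    using assms by (simp add: val_take_word_inv word_dist_mult_left)
  also have "\<dots> \<le> word_dist (val (take ?i u)) (val (take ?i v)) +
      word_dist (val (take ?i v)) (val (take ?j v))"
    using assms by (intro word_dist_triangle) auto
  also have "\<dots> \<le> K + C"
  proof (rule add_mono)
    show "word_dist (val (take ?i u)) (val (take ?i v)) \<le> K"
      using assms(1) by (simp add: fellow_def)
    have "max ?i ?j - min ?i ?j \<le> C" using assms(5,6) by linarith
    then show "word_dist (val (take ?i v)) (val (take ?j v)) \<le> C"
      using word_dist_take_le[OF assms(3), of ?i ?j] by simp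
  qed
  finally show "word_dist (val (take n (word_inv \<iota> u))) (val (take n (word_inv \<iota> v))) \<le> K + C" .
qed

subsection \<open>Lengths of fellow travelling words\<close>

lemma tail_near_endpoint_bounded:
  assumes "regular_language A L" "finite_to_one G ev L"
  shows "\<exists>C. \<forall>x y. x @ y \<in> L \<longrightarrow>
    (\<forall>i\<le>length y. word_dist (val (x @ take i y)) (val (x @ y)) \<le> K) \<longrightarrow> length y \<le> C"
proof -
  obtain Q :: "nat set" and q0 \<delta> F where Q: "finite Q" "q0 \<in> Q" "\<forall>q\<in>Q. \<forall>a\<in>A. \<delta> q a \<in> Q"
    and L: "L = {w \<in> lists A. foldl \<delta> q0 w \<in> F}"
    using assms(1) unfolding regular_language_def by blast
  let ?B = "{g \<in> carrier G. word_norm g \<le> K}"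
  have run: "foldl \<delta> q w \<in> Q" if "w \<in> lists A" "q \<in> Q" for w q
    using that Q(3) by (induction w arbitrary: q) auto
  have "length y \<le> card (Q \<times> ?B)" if xy: "x @ y \<in> L"
    and near: "\<And>i. i \<le> length y \<Longrightarrow> word_dist (val (x @ take i y)) (val (x @ y)) \<le> K" for x y
  proof (rule ccontr)
    assume long: "\<not> length y \<le> card (Q \<times> ?B)"
    have xyA: "x \<in> lists A" "y \<in> lists A" using xy L by auto
    \<comment> \<open>Two equal values of \<open>f\<close> enclose a subword that can be pumped.\<close>
    define f where "f i = (foldl \<delta> q0 (x @ take i y), inv (val (x @ take i y)) \<otimes> val (x @ y))" for i
    have in_A: "x @ take i y \<in> lists A" for i using xyA take_lists by auto
    \<comment> \<open>The second component of \<open>f i\<close> leads from the prefix to the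
      endpoint, so its norm is the distance bounded by \<open>near\<close>.\<close>
    have "f ` {..length y} \<subseteq> Q \<times> ?B"
      using near run[OF in_A Q(2)] val_closed[OF in_A] val_closed[OF in_A[of "length y"]]
      unfolding f_def word_dist_def by auto
    then have "card (f ` {..length y}) \<le> card (Q \<times> ?B)"
      using Q(1) finite_word_ball by (intro card_mono) auto
    then have "\<not> inj_on f {..length y}"
      using long card_image[of f "{..length y}"] by auto
    then obtain i j where ij: "i < j" "j \<le> length y" "f i = f j"
      unfolding inj_on_def by (metis atMost_iff linorder_neqE_nat)
    define p m z where "p = x @ take i y" and "m = drop i (take j y)" and "z = drop j y"
    have "take j y = take i y @ m"
      using ij(1) unfolding m_def by (metis append_take_drop_id less_imp_le min.absorb1 take_take)
    then have pm: "x @ take j y = p @ m" and pmz: "x @ y = p @ m @ z"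
      unfolding p_def z_def by (simp, metis append.assoc append_take_drop_id)
    have mne: "m \<noteq> []" using ij unfolding m_def by auto
    have A: "p \<in> lists A" "m \<in> lists A" "z \<in> lists A"
      using xyA unfolding p_def m_def z_def by simp_all
    have state: "foldl \<delta> (foldl \<delta> q0 p) m = foldl \<delta> q0 p"
      using ij(3) pm unfolding f_def p_def[symmetric] by simp
    \<comment> \<open>Equality of the second components of \<open>f i\<close> and
      \<open>f j\<close>: cancelling the common endpoint shows that \<open>m\<close> has trivial
      value.\<close>
    have "inv (val p) \<otimes> val (x @ y) = inv (val (p @ m)) \<otimes> val (x @ y)"
      using ij(3) pm unfolding f_def p_def[symmetric] by simp
    then have "inv (val p) = inv (val (p @ m))"
      using A in_A[of "length y"] right_cancel[of "val (x @ y)" "inv (val p)" "inv (val (p @ m))"] by simp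
    then have "val (p @ m) = val p"
      using A by (metis append_in_lists_conv inv_inv val_closed)
    then have m1: "val m = \<one>"
      using A by (simp add: val_append)
    \<comment> \<open>Repeating \<open>m\<close> changes neither the state reached after
      \<open>p\<close> nor the value, so each \<open>pump n\<close> lies in \<open>L\<close> above
      the same element. As \<open>m\<close> is nonempty, the lengths distinguish these
      words.\<close>
    define pump where "pump n = p @ concat (replicate n m) @ z" for n
    have rep: "concat (replicate n m) \<in> lists A \<and> val (concat (replicate n m)) = \<one> \<and>
        foldl \<delta> (foldl \<delta> q0 p) (concat (replicate n m)) = foldl \<delta> q0 p" for n
      using A m1 state by (induction n) (auto simp: val_append)
    have "pump n \<in> {w \<in> L. val w = val (x @ y)}" for n
      using rep[of n] A xy m1 state unfolding L pmz pump_def by (auto simp: val_append)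
    then have "range pump \<subseteq> {w \<in> L. val w = val (x @ y)}" by blast
    moreover have "inj pump"
    proof (rule injI)
      fix n n' assume "pump n = pump n'"
      then have "length (concat (replicate n m)) = length (concat (replicate n' m))"
        by (simp add: pump_def)
      then show "n = n'" using mne by (simp add: length_concat sum_list_replicate)
    qed
    ultimately have "infinite {w \<in> L. val w = val (x @ y)}"
      using infinite_super finite_imageD infinite_UNIV_nat by blast
    moreover have "val (x @ y) \<in> carrier G" using in_A[of "length y"] by auto
    ultimately show False using assms(2) unfolding finite_to_one_def by blast
  qed
  then show ?thesis by blast
qed

text \<open>Once the shorter word has been read its path rests at the common endpoint, so what
  remains of the longer word stays near that endpoint and is a tail of bounded length. Only
  \<open>w\<close> and \<open>v\<close> belong to \<open>L\<close>, hence the tail has to be cut out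
  of \<open>w\<close> rather than out of \<open>a @ w @ b\<close>.\<close>

lemma fellow_length_bounded:
  assumes "regular_language A L" "finite_to_one G ev L"
  shows "\<exists>C. \<forall>w\<in>L. \<forall>v\<in>L. \<forall>a\<in>letters_or_empty A. \<forall>b\<in>letters_or_empty A.
    val (a @ w @ b) = val v \<longrightarrow> fellow K (a @ w @ b) v \<longrightarrow>
    length (a @ w @ b) \<le> length v + C \<and> length v \<le> length (a @ w @ b) + C"
proof -
  \<comment> \<open>The radius is \<open>K + 1\<close> because the endpoint of \<open>w\<close> is,
    up to translation by \<open>val a\<close>, within distance 1 of the endpoint of
    \<open>a @ w @ b\<close>.\<close>
  obtain C where C: "\<forall>x y. x @ y \<in> L \<longrightarrow>
    (\<forall>i\<le>length y. word_dist (val (x @ take i y)) (val (x @ y)) \<le> K + 1) \<longrightarrow> length y \<le> C"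
    using tail_near_endpoint_bounded[OF assms] ..
  \<comment> \<open>The summand 2 allows for the letters \<open>a\<close> and \<open>b\<close>,
    which lie outside \<open>w\<close>.\<close>
  have "length (a @ w @ b) \<le> length v + (C + 2) \<and> length v \<le> length (a @ w @ b) + (C + 2)"
    if wv: "w \<in> L" "v \<in> L" and ab: "a \<in> letters_or_empty A" "b \<in> letters_or_empty A"
      and eq: "val (a @ w @ b) = val v" and fel: "fellow K (a @ w @ b) v" for a w b v
  proof
    let ?u = "a @ w @ b"
    have wA: "w \<in> lists A" "v \<in> lists A" "a \<in> lists A" "b \<in> lists A"
      using wv regular_language_subset[OF assms(1)] ab letters_or_empty_lists by auto
    then have uA: "?u \<in> lists A" by auto
    \<comment> \<open>The word \<open>w\<close> is cut where \<open>v\<close> has just been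
      exhausted; the subtraction accounts for the time spent on \<open>a\<close>. If
      \<open>v\<close> is shorter than \<open>a\<close>, truncation makes all of \<open>w\<close>
      the tail.\<close>
    define x y where "x = take (length v - length a) w" and "y = drop (length v - length a) w"
    have xy: "w = x @ y" and xyA: "x \<in> lists A" "y \<in> lists A"
      using wA unfolding x_def y_def by simp_all
    have "length y \<le> C" if "length v \<le> length a + length w"
    proof (rule C[rule_format])
      show "x @ y \<in> L" using wv xy by simp
      fix i assume i: "i \<le> length y"
      define z where "z = x @ take i y"
      have zA: "z \<in> lists A" using xyA take_lists unfolding z_def by auto
      have "length v \<le> length (a @ z)" using that i unfolding z_def x_def by auto
      moreover have "take (length (a @ z)) ?u = a @ z"
        using i unfolding xy z_def by simp
      ultimately have "word_dist (val (a @ z)) (val ?u) \<le> K"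
        using fel[unfolded fellow_def, rule_format, of "length (a @ z)"] eq by (metis take_all)
      then have "word_dist (val z) (val w \<otimes> val b) \<le> K"
        using wA zA by (simp add: val_append word_dist_mult_left)
      moreover have "word_dist (val w \<otimes> val b) (val w) \<le> 1"
        using word_dist_val_le[of "val w" b] word_dist_commute[of "val w \<otimes> val b" "val w"]
          wA letters_or_empty_length[OF ab(2)] by auto
      ultimately show "word_dist (val (x @ take i y)) (val (x @ y)) \<le> K + 1"
        using word_dist_triangle[of "val z" "val w \<otimes> val b" "val w"] wA zA
        unfolding xy[symmetric] z_def[symmetric] by auto
    qed
    then show "length ?u \<le> length v + (C + 2)"
      using letters_or_empty_length[OF ab(1)] letters_or_empty_length[OF ab(2)]
      unfolding y_def by (cases "length v \<le> length a + length w") auto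
  next
    let ?u = "a @ w @ b"
    have wA: "w \<in> lists A" "v \<in> lists A" "a \<in> lists A" "b \<in> lists A"
      using wv regular_language_subset[OF assms(1)] ab letters_or_empty_lists by auto
    \<comment> \<open>Now \<open>a @ w @ b\<close> rests at its endpoint while \<open>v\<close>
      moves on. Since \<open>v\<close> itself lies in \<open>L\<close>, its tail can be used
      directly.\<close>
    define x y where "x = take (length ?u) v" and "y = drop (length ?u) v"
    have xy: "v = x @ y" unfolding x_def y_def by simp
    have "length y \<le> C" if "length ?u \<le> length v"
    proof (rule C[rule_format])
      show "x @ y \<in> L" using wv xy by simp
      fix i
      have "length x = length ?u" using that unfolding x_def by auto
      then have "take (length ?u + i) v = x @ take i y" unfolding xy by simp
      then have "word_dist (val v) (val (x @ take i y)) \<le> K"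
        using fel[unfolded fellow_def, rule_format, of "length ?u + i"] eq by simp
      moreover have "x @ take i y \<in> lists A"
        using wA take_lists unfolding x_def y_def by simp
      ultimately show "word_dist (val (x @ take i y)) (val (x @ y)) \<le> K + 1"
        using word_dist_commute[of "val v" "val (x @ take i y)"] wA xy by auto
    qed
    then show "length v \<le> length ?u + (C + 2)"
      unfolding y_def by (cases "length ?u \<le> length v") auto
  qed
  then show ?thesis by blast
qed

subsection \<open>The inverse language\<close>

lemma mem_word_inv_image_iff:
  assumes "L \<subseteq> lists A"
  shows "w \<in> word_inv \<iota> ` L \<longleftrightarrow> w \<in> lists A \<and> word_inv \<iota> w \<in> L"
proof
  assume "w \<in> lists A \<and> word_inv \<iota> w \<in> L"
  then show "w \<in> word_inv \<iota> ` L"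
    by (intro image_eqI[of _ _ "word_inv \<iota> w"]) auto
qed (use assms in \<open>auto simp: subset_iff\<close>)

text \<open>The automaton reading backwards: its state is the set of states from which the
  inverse of the word read so far leads to acceptance.\<close>

lemma regular_language_word_inv:
  assumes "regular_language A L"
  shows "regular_language A (word_inv \<iota> ` L)"
proof -
  obtain Q :: "nat set" and q0 \<delta> F where Q: "finite Q" "q0 \<in> Q" "F \<subseteq> Q" "\<forall>q\<in>Q. \<forall>a\<in>A. \<delta> q a \<in> Q"
    and L: "L = {w \<in> lists A. foldl \<delta> q0 w \<in> F}"
    using assms unfolding regular_language_def by blast
  define \<delta>' where "\<delta>' S a = {q \<in> Q. \<delta> q (\<iota> a) \<in> S}" for S a
  have run: "foldl \<delta>' F w = {q \<in> Q. foldl \<delta> q (word_inv \<iota> w) \<in> F}" if "w \<in> lists A" for w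
    using that
  \<comment> \<open>A letter appended to \<open>w\<close> becomes, inverted, the first letter of the
    formal inverse; this is the preimage taken by \<open>\<delta>'\<close>.\<close>
  proof (induction w rule: rev_induct)
    case Nil
    then show ?case using Q(3) by (auto simp: word_inv_def)
  next
    case (snoc a w)
    then show ?case using Q(4) by (auto simp: \<delta>'_def word_inv_def)
  qed
  show ?thesis
  proof (rule regular_languageI)
    show "finite (Pow Q)" "F \<in> Pow Q" using Q by auto
    show "\<delta>' S a \<in> Pow Q" for S a by (auto simp: \<delta>'_def)
    show "word_inv \<iota> ` L = {w \<in> lists A. foldl \<delta>' F w \<in> {S. q0 \<in> S}}"
      unfolding set_eq_iff mem_word_inv_image_iff[OF regular_language_subset[OF assms]]
      using run Q(2) by (auto simp: L)
  qed
qed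

lemma finite_to_one_word_inv:
  assumes "L \<subseteq> lists A" "finite_to_one G ev L"
  shows "finite_to_one G ev (word_inv \<iota> ` L)"
  unfolding finite_to_one_def
proof
  fix g assume g: "g \<in> carrier G"
  have "{w \<in> word_inv \<iota> ` L. val w = g} \<subseteq> word_inv \<iota> ` {w \<in> L. val w = inv g}"
    using assms(1) g by (auto simp: val_word_inv subset_iff)
  moreover have "finite {w \<in> L. val w = inv g}"
    using assms(2) g unfolding finite_to_one_def by simp
  ultimately show "finite {w \<in> word_inv \<iota> ` L. val w = g}"
    by (rule finite_subset[OF _ finite_imageI])
qed

lemma val_image_word_inv:
  assumes "L \<subseteq> lists A" "val ` L = carrier G"
  shows "val ` word_inv \<iota> ` L = carrier G"
proof -
  have "val ` word_inv \<iota> ` L = (\<lambda>g. inv g) ` val ` L"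
    unfolding image_image using assms(1) by (intro image_cong) (auto simp: val_word_inv)
  also have "\<dots> = carrier G"
    unfolding assms(2) by (auto simp: image_iff) (metis inv_closed inv_inv)
  finally show ?thesis .
qed

section \<open>Both conditions as fellow travelling, and the implications between them\<close>

lemma automatic_structure_iff_fellow:
  assumes "regular_language A L" "val ` L = carrier G"
  shows "automatic_structure G ev A L \<longleftrightarrow>
    (\<exists>K. \<forall>w1\<in>L. \<forall>w2\<in>L. \<forall>a\<in>letters_or_empty A.
      val (w1 @ a) = val w2 \<longrightarrow> fellow K (w1 @ a) w2)"
proof -
  let ?P = "{(w1 @ a, w2) | w1 a w2. w1 \<in> L \<and> w2 \<in> L \<and> a \<in> letters_or_empty A \<and>
    val (w1 @ a) = val w2}"
  have "u \<in> lists A \<and> v \<in> lists A" if "(u, v) \<in> ?P" for u v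
    using that regular_language_subset[OF assms(1)] letters_or_empty_lists by auto
  note bounded = path_dist_bounded_iff_fellow[of ?P, OF this]
  have P: "(\<forall>(u, v)\<in>?P. R u v) \<longleftrightarrow> (\<forall>w1\<in>L. \<forall>w2\<in>L. \<forall>a\<in>letters_or_empty A.
      val (w1 @ a) = val w2 \<longrightarrow> R (w1 @ a) w2)" for R
    by blast
  show ?thesis
    using assms fin ev gen bounded[unfolded P]
    by (simp add: automatic_structure_def generates_as_semigroup_def)
qed

lemma two_sided_iff_fellow:
  assumes "L \<subseteq> lists A"
  shows "(\<exists>k. \<forall>w1\<in>L. \<forall>w2\<in>L. \<forall>a\<in>letters_or_empty A. \<forall>b\<in>letters_or_empty A.
      val (a @ w1 @ b) = val w2 \<longrightarrow> path_dist G A ev (a @ w1 @ b) w2 \<le> k) \<longleftrightarrow>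
    (\<exists>K. \<forall>w1\<in>L. \<forall>w2\<in>L. \<forall>a\<in>letters_or_empty A. \<forall>b\<in>letters_or_empty A.
      val (a @ w1 @ b) = val w2 \<longrightarrow> fellow K (a @ w1 @ b) w2)"
proof -
  let ?P = "{(a @ w1 @ b, w2) | a w1 b w2. w1 \<in> L \<and> w2 \<in> L \<and> a \<in> letters_or_empty A \<and>
    b \<in> letters_or_empty A \<and> val (a @ w1 @ b) = val w2}"
  have "u \<in> lists A \<and> v \<in> lists A" if "(u, v) \<in> ?P" for u v
    using that assms letters_or_empty_lists by auto
  note bounded = path_dist_bounded_iff_fellow[of ?P, OF this]
  have P: "(\<forall>(u, v)\<in>?P. R u v) \<longleftrightarrow>
      (\<forall>w1\<in>L. \<forall>w2\<in>L. \<forall>a\<in>letters_or_empty A. \<forall>b\<in>letters_or_empty A.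
        val (a @ w1 @ b) = val w2 \<longrightarrow> R (a @ w1 @ b) w2)" for R
    by blast
  show ?thesis using bounded[unfolded P] .
qed

text \<open>The path from \<open>a @ w1 @ b\<close> to \<open>w2\<close> leads through
  \<open>a @ w3\<close>, where \<open>w3\<close> in \<open>L\<close> represents
  \<open>w1 @ b\<close>. The first comparison is \<open>right\<close> translated by
  \<open>val a\<close>; the second is \<open>left\<close> read backwards.\<close>

lemma two_sided_if_automatic:
  assumes L: "regular_language A L" "finite_to_one G ev L" "val ` L = carrier G"
    and right: "\<And>w1 w2 b. w1 \<in> L \<Longrightarrow> w2 \<in> L \<Longrightarrow> b \<in> letters_or_empty A \<Longrightarrow>
      val (w1 @ b) = val w2 \<Longrightarrow> fellow K (w1 @ b) w2"
    and left: "\<And>w1 w2 b. w1 \<in> word_inv \<iota> ` L \<Longrightarrow> w2 \<in> word_inv \<iota> ` L \<Longrightarrow> b \<in> letters_or_empty A \<Longrightarrow>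
      val (w1 @ b) = val w2 \<Longrightarrow> fellow K' (w1 @ b) w2"
  shows "\<exists>K. \<forall>w1\<in>L. \<forall>w2\<in>L. \<forall>a\<in>letters_or_empty A. \<forall>b\<in>letters_or_empty A.
    val (a @ w1 @ b) = val w2 \<longrightarrow> fellow K (a @ w1 @ b) w2"
proof -
  note LA = regular_language_subset[OF L(1)]
  \<comment> \<open>The length bound is taken for the inverse language, because the pair known to be
    fellow travelling before the reversal comes from there.\<close>
  obtain C where C: "\<forall>w\<in>word_inv \<iota> ` L. \<forall>v\<in>word_inv \<iota> ` L.
    \<forall>a\<in>letters_or_empty A. \<forall>b\<in>letters_or_empty A.
    val (a @ w @ b) = val v \<longrightarrow> fellow K' (a @ w @ b) v \<longrightarrow>
    length (a @ w @ b) \<le> length v + C \<and> length v \<le> length (a @ w @ b) + C"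
    using fellow_length_bounded[OF regular_language_word_inv[OF L(1)]
        finite_to_one_word_inv[OF LA L(2)]] ..
  have "fellow (K + (K' + C)) (a @ w1 @ b) w2"
    if w: "w1 \<in> L" "w2 \<in> L" and ab: "a \<in> letters_or_empty A" "b \<in> letters_or_empty A"
      and eq: "val (a @ w1 @ b) = val w2" for w1 w2 a b
  proof -
    have A: "w1 \<in> lists A" "w2 \<in> lists A" "a \<in> lists A" "b \<in> lists A"
      using w LA ab letters_or_empty_lists by auto
    then have "w1 @ b \<in> lists A" by auto
    then obtain w3 where w3: "w3 \<in> L" "val (w1 @ b) = val w3"
      using L(3) val_closed by (metis imageE)
    have w3A: "w3 \<in> lists A" using w3 LA by auto
    have eq3: "val (a @ w3) = val w2"
      using eq w3(2) A w3A by (simp add: val_append)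
    have 1: "fellow K (a @ w1 @ b) (a @ w3)"
      using right[OF w(1) w3(1) ab(2) w3(2)] A w3A by (intro fellow_prepend) auto
    \<comment> \<open>Inversion turns the left factor \<open>a\<close> into a right factor, again a
      letter or empty, so that \<open>left\<close> applies to \<open>?u\<close> and
      \<open>?v\<close>.\<close>
    let ?u = "word_inv \<iota> w3 @ word_inv \<iota> a" and ?v = "word_inv \<iota> w2"
    have u: "?u = word_inv \<iota> (a @ w3)" by (simp add: word_inv_append)
    have aw3: "a @ w3 \<in> lists A" using A w3A by auto
    have equ: "val ?u = val ?v"
      unfolding u using eq3 aw3 A by (simp only: val_word_inv)
    have mem: "word_inv \<iota> w3 \<in> word_inv \<iota> ` L" "?v \<in> word_inv \<iota> ` L"
        "word_inv \<iota> a \<in> letters_or_empty A" "[] \<in> letters_or_empty A"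
      using w w3 ab letters_or_empty_word_inv by (auto simp: letters_or_empty_def)
    have felu: "fellow K' ?u ?v"
      using left[OF mem(1,2,3) equ] .
    have "length ?u \<le> length ?v + C \<and> length ?v \<le> length ?u + C"
      using C[rule_format, OF mem(1,2,4,3)] equ felu by simp
    then have "fellow (K' + C) (word_inv \<iota> ?u) (word_inv \<iota> ?v)"
      using felu equ A w3A by (intro fellow_word_inv) auto
    then have "fellow (K' + C) (a @ w3) w2"
      unfolding u using aw3 A by (simp only: word_inv_word_inv)
    then show ?thesis
      using fellow_trans[OF 1] A w3A by auto
  qed
  then show ?thesis by blast
qed

text \<open>Right multiplication by \<open>a\<close> in the inverse language is, read backwards,
  left multiplication by the inverse of \<open>a\<close> in \<open>L\<close>. The length bound for
  \<open>L\<close> makes this reversal possible at the cost of \<open>C\<close>.\<close>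

lemma inverse_automatic_if_two_sided:
  assumes L: "regular_language A L" "finite_to_one G ev L"
    and two_sided: "\<And>w1 w2 a. w1 \<in> L \<Longrightarrow> w2 \<in> L \<Longrightarrow> a \<in> letters_or_empty A \<Longrightarrow>
      val (a @ w1) = val w2 \<Longrightarrow> fellow K (a @ w1) w2"
  shows "\<exists>K. \<forall>w1\<in>word_inv \<iota> ` L. \<forall>w2\<in>word_inv \<iota> ` L. \<forall>a\<in>letters_or_empty A.
    val (w1 @ a) = val w2 \<longrightarrow> fellow K (w1 @ a) w2"
proof -
  note LA = regular_language_subset[OF L(1)]
  obtain C where C: "\<forall>w\<in>L. \<forall>v\<in>L. \<forall>a\<in>letters_or_empty A. \<forall>b\<in>letters_or_empty A.
    val (a @ w @ b) = val v \<longrightarrow> fellow K (a @ w @ b) v \<longrightarrow>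
    length (a @ w @ b) \<le> length v + C \<and> length v \<le> length (a @ w @ b) + C"
    using fellow_length_bounded[OF L] ..
  have "fellow (K + C) (word_inv \<iota> w1 @ a) (word_inv \<iota> w2)"
    if w: "w1 \<in> L" "w2 \<in> L" and a: "a \<in> letters_or_empty A"
      and eq: "val (word_inv \<iota> w1 @ a) = val (word_inv \<iota> w2)" for w1 w2 a
  proof -
    have A: "w1 \<in> lists A" "w2 \<in> lists A" "a \<in> lists A"
      using w LA a letters_or_empty_lists by auto
    let ?u = "word_inv \<iota> a @ w1"
    have uA: "?u \<in> lists A" using A by simp
    have u: "word_inv \<iota> w1 @ a = word_inv \<iota> ?u"
      using A by (simp add: word_inv_append)
    have "inv (val ?u) = inv (val w2)"
      using eq uA A unfolding u by (simp only: val_word_inv)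
    then have equ: "val ?u = val w2"
      by (rule inj_onD[OF inv_inj]) (use uA A(2) in auto)
    have felu: "fellow K ?u w2"
      using two_sided[OF w letters_or_empty_word_inv[OF a] equ] .
    have "length ?u \<le> length w2 + C \<and> length w2 \<le> length ?u + C"
      using C[rule_format, OF w letters_or_empty_word_inv[OF a], of "[]"] equ felu
      by (simp add: letters_or_empty_def)
    then show ?thesis
      unfolding u by (intro fellow_word_inv[OF felu uA A(2) equ]) auto
  qed
  then show ?thesis by (intro exI[of _ "K + C"]) auto
qed

end

theorem theorem6:
  fixes G :: "('g, 'm) monoid_scheme"
    and A :: "'a set" and ev :: "'a \<Rightarrow> 'g" and \<iota> :: "'a \<Rightarrow> 'a"
    and L :: "'a list set"
  assumes "group G"
    and "finite A"
    and "ev \<in> A \<rightarrow> carrier G"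
    and "generate G (ev ` A) = carrier G"
    and "closed_under_inversion G A ev \<iota>"
    and "regular_language A L"
    and "finite_to_one G ev L"
    and "word_val G ev ` L = carrier G"
  shows "biautomatic_structure G ev \<iota> A L \<longleftrightarrow>
    (\<exists>k :: real. \<forall>w1\<in>L. \<forall>w2\<in>L. \<forall>a\<in>letters_or_empty A. \<forall>b\<in>letters_or_empty A.
       word_val G ev (a @ w1 @ b) = word_val G ev w2 \<longrightarrow>
       path_dist G A ev (a @ w1 @ b) w2 \<le> k)"
proof -
  interpret group G by fact
  note LA = regular_language_subset[OF assms(6)]
  have "word_val G ev w \<in> carrier G" if "w \<in> lists A" for w
    using that by (induction w) (simp_all add: word_val_def Pi_mem[OF assms(3)])
  \<comment> \<open>Generation by words, as the locale demands it, follows from \<open>L\<close>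
    alone: its words are words over \<open>A\<close> and already represent the whole group.\<close>
  then have "word_val G ev ` lists A = carrier G"
    using image_mono[OF LA, of "word_val G ev"] unfolding assms(8) by auto
  then interpret inverse_closed_generators G A ev \<iota>
    using assms(2,3,5) by unfold_locales
  note inverse = regular_language_word_inv[OF assms(6)] val_image_word_inv[OF LA assms(8)]
  have bi: "biautomatic_structure G ev \<iota> A L \<longleftrightarrow>
      automatic_structure G ev A L \<and> automatic_structure G ev A (word_inv \<iota> ` L)"
    using assms(5,8) LA by (simp add: biautomatic_structure_def)
  show ?thesis
    unfolding bi two_sided_iff_fellow[OF LA] automatic_structure_iff_fellow[OF assms(6,8)]
      automatic_structure_iff_fellow[OF inverse]
  proof (intro iffI conjI; elim conjE exE)
    fix K K'
    assume right: "\<forall>w1\<in>L. \<forall>w2\<in>L. \<forall>a\<in>letters_or_empty A.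
        val (w1 @ a) = val w2 \<longrightarrow> fellow K (w1 @ a) w2"
      and left: "\<forall>w1\<in>word_inv \<iota> ` L. \<forall>w2\<in>word_inv \<iota> ` L. \<forall>a\<in>letters_or_empty A.
        val (w1 @ a) = val w2 \<longrightarrow> fellow K' (w1 @ a) w2"
    show "\<exists>K. \<forall>w1\<in>L. \<forall>w2\<in>L. \<forall>a\<in>letters_or_empty A. \<forall>b\<in>letters_or_empty A.
        val (a @ w1 @ b) = val w2 \<longrightarrow> fellow K (a @ w1 @ b) w2"
      by (rule two_sided_if_automatic[OF assms(6-8) right[rule_format] left[rule_format]])
  next
    fix K
    assume "\<forall>w1\<in>L. \<forall>w2\<in>L. \<forall>a\<in>letters_or_empty A. \<forall>b\<in>letters_or_empty A.
        val (a @ w1 @ b) = val w2 \<longrightarrow> fellow K (a @ w1 @ b) w2"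
    note K = this[rule_format]
    \<comment> \<open>An empty left factor specializes the two-sided condition to the one for
      \<open>L\<close>; an empty right factor gives the hypothesis from which the inverse language
      is treated.\<close>
    have Nil: "[] \<in> letters_or_empty A" by (simp add: letters_or_empty_def)
    show "\<exists>K. \<forall>w1\<in>L. \<forall>w2\<in>L. \<forall>a\<in>letters_or_empty A.
        val (w1 @ a) = val w2 \<longrightarrow> fellow K (w1 @ a) w2"
      using K[OF _ _ Nil] by (intro exI[of _ K]) simp
    show "\<exists>K. \<forall>w1\<in>word_inv \<iota> ` L. \<forall>w2\<in>word_inv \<iota> ` L. \<forall>a\<in>letters_or_empty A.
        val (w1 @ a) = val w2 \<longrightarrow> fellow K (w1 @ a) w2"
      using K[OF _ _ _ Nil] by (intro inverse_automatic_if_two_sided[OF assms(6,7), of K]) simp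
  qed
qed

end
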